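(* Let $F:\mathcal{A}\to\mathcal{C}$ be a form such that $f.A$ and $B.f$ exist for every $\mathcal{C}$-morphism $f:X\to Y$, $A\in F^{-1}X$, $B\in F^{-1}Y$, and let $\sqsubset$ be a topogenous order on $F$. A $\mathcal{C}$-morphism $f:X\to Y$ is $\sqsubset$-strict if and only if $\sqsubset$ preserves the codomains of cocartesian liftings of $f$, i.e. $A\sqsubset_X B\Rightarrow f.A\sqsubset_Y f.B$ for all $A,B\in F^{-1}X$.
   Context: A form over a category $\mathcal{C}$ is a functor $F:\mathcal{A}\to\mathcal{C}$ that is faithful and amnestic (an isomorphism $h:A\to B$ in $\mathcal{A}$ with $Fh=1_{FA}$ satisfies $A=B$, $h=1_A$). The fibre $F^{-1}X$ consists of the objects $A$ with $FA=X$. For $f:X\to Y$ in $\mathcal{C}$, $A\in F^{-1}X$, $B\in F^{-1}Y$, write $A\leq_f B$ if there is an $\mathcal{A}$-morphism $\alpha:A\to B$ with $F\alpha=f$; $\leq_X$ means $\leq_{1_X}$, a partial order on $F^{-1}X$. The object $f.A\in F^{-1}Y$ is the codomain of a cocartesian lifting of $f$ at $A$: $A\leq_f f.A$, and for all $C\in\mathcal{A}$ and $g:Y\to FC$, $f.A\leq_g C\Leftrightarrow A\leq_{g\circ f}C$. Dually, $B.f\in F^{-1}X$ is the domain of a cartesian lifting of $f$ at $B$: $B.f\leq_f B$, and for all $C\in\mathcal{A}$ and $g:FC\to X$, $C\leq_g B.f\Leftrightarrow C\leq_{f\circ g}B$. A topogenous order $\sqsubset$ on $F$ is a family of binary relations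 $\sqsubset_X$ on $F^{-1}X$ ($X\in\mathcal{C}$) with (T1) $A\sqsubset_X B\Rightarrow A\leq_X B$; (T2) $A'\leq_X A\sqsubset_X B\leq_X B'\Rightarrow A'\sqsubset_X B'$; (T3) for every $f:X\to Y$ in $\mathcal{C}$, $A\in F^{-1}X$, $B\in F^{-1}Y$: $f.A\sqsubset_Y B\Rightarrow A\sqsubset_X B.f$. A morphism $f:X\to Y$ is $\sqsubset$-strict if $A\sqsubset_X B.f\Rightarrow f.A\sqsubset_Y B$ for all $A\in F^{-1}X$, $B\in F^{-1}Y$. *)

theory Defs
  imports Main
begin

record ('o, 'm) category =
  Ob :: "'o set"
  Mor :: "'m set"
  Dom :: "'m \<Rightarrow> 'o"
  Cod :: "'m \<Rightarrow> 'o"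
  Id :: "'o \<Rightarrow> 'm"
  Comp :: "'m \<Rightarrow> 'm \<Rightarrow> 'm"  \<comment> \<open>\<open>Comp C g f\<close> is \<open>g\<close> after \<open>f\<close>\<close>

definition hom :: "('o, 'm, 'z) category_scheme \<Rightarrow> 'o \<Rightarrow> 'o \<Rightarrow> 'm set" where
  "hom C X Y = {f \<in> Mor C. Dom C f = X \<and> Cod C f = Y}"

locale category =
  fixes C :: "('o, 'm, 'z) category_scheme"
  assumes Dom_in: "f \<in> Mor C \<Longrightarrow> Dom C f \<in> Ob C"
    and Cod_in: "f \<in> Mor C \<Longrightarrow> Cod C f \<in> Ob C"
    and Id_in: "X \<in> Ob C \<Longrightarrow> Id C X \<in> hom C X X"
    and Comp_in: "f \<in> hom C X Y \<Longrightarrow> g \<in> hom C Y Z \<Longrightarrow> Comp C g f \<in> hom C X Z"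
    and Comp_Id: "f \<in> hom C X Y \<Longrightarrow> Comp C f (Id C X) = f"
    and Id_Comp: "f \<in> hom C X Y \<Longrightarrow> Comp C (Id C Y) f = f"
    and Comp_assoc: "f \<in> hom C W X \<Longrightarrow> g \<in> hom C X Y \<Longrightarrow> h \<in> hom C Y Z \<Longrightarrow>
      Comp C h (Comp C g f) = Comp C (Comp C h g) f"

definition iso :: "('o, 'm, 'z) category_scheme \<Rightarrow> 'o \<Rightarrow> 'o \<Rightarrow> 'm \<Rightarrow> bool" where
  "iso C X Y h \<longleftrightarrow> h \<in> hom C X Y \<and>
    (\<exists>k \<in> hom C Y X. Comp C k h = Id C X \<and> Comp C h k = Id C Y)"

record ('ao, 'am, 'co, 'cm) functor_data =
  source :: "('ao, 'am) category"
  target :: "('co, 'cm) category"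
  omap :: "'ao \<Rightarrow> 'co"
  mmap :: "'am \<Rightarrow> 'cm"

locale is_functor =
  source: category "source F" + target: category "target F"
  for F :: "('ao, 'am, 'co, 'cm) functor_data" +
  assumes omap_in: "A \<in> Ob (source F) \<Longrightarrow> omap F A \<in> Ob (target F)"
    and mmap_in: "\<alpha> \<in> hom (source F) A B \<Longrightarrow> mmap F \<alpha> \<in> hom (target F) (omap F A) (omap F B)"
    and mmap_Id: "A \<in> Ob (source F) \<Longrightarrow> mmap F (Id (source F) A) = Id (target F) (omap F A)"
    and mmap_Comp: "\<alpha> \<in> hom (source F) A B \<Longrightarrow> \<beta> \<in> hom (source F) B D \<Longrightarrow>
      mmap F (Comp (source F) \<beta> \<alpha>) = Comp (target F) (mmap F \<beta>) (mmap F \<alpha>)"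

locale form = is_functor F for F :: "('ao, 'am, 'co, 'cm) functor_data" +
  assumes faithful: "\<alpha> \<in> hom (source F) A B \<Longrightarrow> \<beta> \<in> hom (source F) A B \<Longrightarrow>
      mmap F \<alpha> = mmap F \<beta> \<Longrightarrow> \<alpha> = \<beta>"
    and amnestic: "iso (source F) A B h \<Longrightarrow> mmap F h = Id (target F) (omap F A) \<Longrightarrow>
      A = B \<and> h = Id (source F) A"

definition fibre :: "('ao, 'am, 'co, 'cm) functor_data \<Rightarrow> 'co \<Rightarrow> 'ao set" where
  "fibre F X = {A \<in> Ob (source F). omap F A = X}"

definition leq_along :: "('ao, 'am, 'co, 'cm) functor_data \<Rightarrow> 'cm \<Rightarrow> 'ao \<Rightarrow> 'ao \<Rightarrow> bool" where
  "leq_along F f A B \<longleftrightarrow> (\<exists>\<alpha> \<in> hom (source F) A B. mmap F \<alpha> = f)"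

abbreviation leq_at :: "('ao, 'am, 'co, 'cm) functor_data \<Rightarrow> 'co \<Rightarrow> 'ao \<Rightarrow> 'ao \<Rightarrow> bool" where
  "leq_at F X \<equiv> leq_along F (Id (target F) X)"

definition is_cocartesian_codomain ::
    "('ao, 'am, 'co, 'cm) functor_data \<Rightarrow> 'cm \<Rightarrow> 'ao \<Rightarrow> 'ao \<Rightarrow> bool" where
  "is_cocartesian_codomain F f A P \<longleftrightarrow>
    P \<in> fibre F (Cod (target F) f) \<and> leq_along F f A P \<and>
    (\<forall>D \<in> Ob (source F). \<forall>g \<in> hom (target F) (Cod (target F) f) (omap F D).
      leq_along F g P D \<longleftrightarrow> leq_along F (Comp (target F) g f) A D)"

definition is_cartesian_domain ::
    "('ao, 'am, 'co, 'cm) functor_data \<Rightarrow> 'cm \<Rightarrow> 'ao \<Rightarrow> 'ao \<Rightarrow> bool" where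
  "is_cartesian_domain F f B P \<longleftrightarrow>
    P \<in> fibre F (Dom (target F) f) \<and> leq_along F f P B \<and>
    (\<forall>D \<in> Ob (source F). \<forall>g \<in> hom (target F) (omap F D) (Dom (target F) f).
      leq_along F g D P \<longleftrightarrow> leq_along F (Comp (target F) f g) D B)"

text \<open>For a form, amnesticity makes the objects \<open>f.A\<close> and \<open>B.f\<close> unique when they exist
  (see the uniqueness lemmas below); the descriptions are only meaningful in that case.\<close>

definition cocart :: "('ao, 'am, 'co, 'cm) functor_data \<Rightarrow> 'cm \<Rightarrow> 'ao \<Rightarrow> 'ao" where
  "cocart F f A = (THE P. is_cocartesian_codomain F f A P)"

definition cart :: "('ao, 'am, 'co, 'cm) functor_data \<Rightarrow> 'ao \<Rightarrow> 'cm \<Rightarrow> 'ao" where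
  "cart F B f = (THE P. is_cartesian_domain F f B P)"

definition has_liftings :: "('ao, 'am, 'co, 'cm) functor_data \<Rightarrow> bool" where
  "has_liftings F \<longleftrightarrow> (\<forall>X \<in> Ob (target F). \<forall>Y \<in> Ob (target F). \<forall>f \<in> hom (target F) X Y.
    (\<forall>A \<in> fibre F X. \<exists>P. is_cocartesian_codomain F f A P) \<and>
    (\<forall>B \<in> fibre F Y. \<exists>P. is_cartesian_domain F f B P))"

text \<open>The values of \<open>R X\<close> for \<open>X\<close> outside \<open>Ob (target F)\<close> are irrelevant and left unconstrained.
  Condition T3 refers to \<open>f.A\<close> and \<open>B.f\<close>, so the notion is intended for forms with
  \<^const>\<open>has_liftings\<close>.\<close>

definition topogenous_order ::
    "('ao, 'am, 'co, 'cm) functor_data \<Rightarrow> ('co \<Rightarrow> 'ao \<Rightarrow> 'ao \<Rightarrow> bool) \<Rightarrow> bool" where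
  "topogenous_order F R \<longleftrightarrow>
    (\<forall>X \<in> Ob (target F). \<forall>A B. R X A B \<longrightarrow> A \<in> fibre F X \<and> B \<in> fibre F X) \<and>
    (\<forall>X \<in> Ob (target F). \<forall>A B. R X A B \<longrightarrow> leq_at F X A B) \<and>
    (\<forall>X \<in> Ob (target F). \<forall>A' A B B'.
      leq_at F X A' A \<and> R X A B \<and> leq_at F X B B' \<longrightarrow> R X A' B') \<and>
    (\<forall>X \<in> Ob (target F). \<forall>Y \<in> Ob (target F). \<forall>f \<in> hom (target F) X Y.
      \<forall>A \<in> fibre F X. \<forall>B \<in> fibre F Y. R Y (cocart F f A) B \<longrightarrow> R X A (cart F B f))"

definition strict_morphism ::
    "('ao, 'am, 'co, 'cm) functor_data \<Rightarrow> ('co \<Rightarrow> 'ao \<Rightarrow> 'ao \<Rightarrow> bool) \<Rightarrow> 'co \<Rightarrow> 'co \<Rightarrow> 'cm \<Rightarrow> bool" where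
  "strict_morphism F R X Y f \<longleftrightarrow>
    (\<forall>A \<in> fibre F X. \<forall>B \<in> fibre F Y. R X A (cart F B f) \<longrightarrow> R Y (cocart F f A) B)"

context form
begin

lemma leq_at_antisym:
  assumes X: "X \<in> Ob (target F)" and AB: "leq_at F X A B" and BA: "leq_at F X B A"
  shows "A = B"
proof -
  obtain h k where h: "h \<in> hom (source F) A B" "mmap F h = Id (target F) X"
    and k: "k \<in> hom (source F) B A" "mmap F k = Id (target F) X"
    using AB BA unfolding leq_along_def by blast
  have obs: "A \<in> Ob (source F)" "B \<in> Ob (source F)"
    using h(1) source.Dom_in source.Cod_in by (auto simp: hom_def)
  have "Id (target F) X \<in> hom (target F) X X" by (rule target.Id_in[OF X])
  with mmap_in[OF h(1)] h(2) have FAB: "omap F A = X" "omap F B = X"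
    by (auto simp: hom_def)
  have II: "Comp (target F) (Id (target F) X) (Id (target F) X) = Id (target F) X"
    using target.Comp_Id[OF target.Id_in[OF X]] .
  have "Comp (source F) k h = Id (source F) A"
    using h k obs FAB II
    by (intro faithful[of _ A A] source.Comp_in source.Id_in) (auto simp: mmap_Comp mmap_Id)
  moreover have "Comp (source F) h k = Id (source F) B"
    using h k obs FAB II
    by (intro faithful[of _ B B] source.Comp_in source.Id_in) (auto simp: mmap_Comp mmap_Id)
  ultimately have "iso (source F) A B h" using h k by (auto simp: iso_def)
  then show ?thesis using amnestic h FAB by auto
qed

lemma leq_at_refl:
  assumes "A \<in> fibre F X"
  shows "leq_at F X A A"
  using assms source.Id_in mmap_Id by (auto simp: fibre_def leq_along_def)

lemma cocartesian_codomain_unique: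
  assumes f: "f \<in> hom (target F) X Y"
    and P: "is_cocartesian_codomain F f A P" and Q: "is_cocartesian_codomain F f A Q"
  shows "P = Q"
proof -
  have Y: "Y \<in> Ob (target F)" and Cod: "Cod (target F) f = Y"
    using f target.Cod_in by (auto simp: hom_def)
  have "leq_at F Y P Q" "leq_at F Y Q P"
    using P Q Cod target.Id_in[OF Y] target.Id_Comp[OF f]
    by (auto simp: is_cocartesian_codomain_def fibre_def)
  then show ?thesis using leq_at_antisym[OF Y] by blast
qed

lemma cartesian_domain_unique:
  assumes f: "f \<in> hom (target F) X Y"
    and P: "is_cartesian_domain F f B P" and Q: "is_cartesian_domain F f B Q"
  shows "P = Q"
proof -
  have X: "X \<in> Ob (target F)" and Dom: "Dom (target F) f = X"
    using f target.Dom_in by (auto simp: hom_def)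
  have "leq_at F X P Q" "leq_at F X Q P"
    using P Q Dom target.Id_in[OF X] target.Comp_Id[OF f]
    by (auto simp: is_cartesian_domain_def fibre_def)
  then show ?thesis using leq_at_antisym[OF X] by blast
qed

lemma is_cocartesian_codomain_cocart:
  assumes "has_liftings F" "f \<in> hom (target F) X Y" "A \<in> fibre F X"
  shows "is_cocartesian_codomain F f A (cocart F f A)"
proof -
  have "X \<in> Ob (target F)" "Y \<in> Ob (target F)"
    using assms(2) target.Dom_in target.Cod_in by (auto simp: hom_def)
  then obtain P where "is_cocartesian_codomain F f A P"
    using assms unfolding has_liftings_def by blast
  then show ?thesis unfolding cocart_def
    using cocartesian_codomain_unique[OF assms(2)] by (metis theI)
qed

lemma is_cartesian_domain_cart:
  assumes "has_liftings F" "f \<in> hom (target F) X Y" "B \<in> fibre F Y"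
  shows "is_cartesian_domain F f B (cart F B f)"
proof -
  have "X \<in> Ob (target F)" "Y \<in> Ob (target F)"
    using assms(2) target.Dom_in target.Cod_in by (auto simp: hom_def)
  then obtain P where "is_cartesian_domain F f B P"
    using assms unfolding has_liftings_def by blast
  then show ?thesis unfolding cart_def
    using cartesian_domain_unique[OF assms(2)] by (metis theI)
qed

end

end

theory Submission
  imports Defs
begin

text \<open>
  For a fixed morphism \<open>f\<close> from \<open>X\<close> to \<open>Y\<close>, the assignments \<open>A \<mapsto> f.A\<close> and \<open>B \<mapsto> B.f\<close> form a
  Galois connection between the fibres over \<open>X\<close> and \<open>Y\<close>: each of the two inequalities
  \<open>f.A \<le>\<^sub>Y B\<close> and \<open>A \<le>\<^sub>X B.f\<close> is the case of the identity in a universal property, and both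
  amount to \<open>A \<le>\<^sub>f B\<close> (\<open>cocart_cart_galois\<close>). Its unit \<open>B \<le>\<^sub>X (f.B).f\<close>
  (\<open>leq_at_cart_cocart\<close>) and counit \<open>f.(B.f) \<le>\<^sub>Y B\<close> (\<open>cocart_cart_leq_at\<close>) give the two
  implications. If \<open>f\<close> is strict, then \<open>A \<sqsubset> B\<close> can be enlarged along the unit to
  \<open>A \<sqsubset> (f.B).f\<close>, and strictness moves \<open>f\<close> to the left. If \<open>f.-\<close> preserves \<open>\<sqsubset>\<close>, then
  \<open>A \<sqsubset> B.f\<close> gives \<open>f.A \<sqsubset> f.(B.f)\<close>, which can be enlarged along the counit to \<open>f.A \<sqsubset> B\<close>.
\<close>

context form
begin

lemma cocart_in_fibre:
  assumes "has_liftings F" "f \<in> hom (target F) X Y" "A \<in> fibre F X"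
  shows "cocart F f A \<in> fibre F Y"
  using is_cocartesian_codomain_cocart[OF assms] assms(2)
  by (simp add: is_cocartesian_codomain_def hom_def)

lemma cart_in_fibre:
  assumes "has_liftings F" "f \<in> hom (target F) X Y" "B \<in> fibre F Y"
  shows "cart F B f \<in> fibre F X"
  using is_cartesian_domain_cart[OF assms] assms(2)
  by (simp add: is_cartesian_domain_def hom_def)

text \<open>The universal property of the cocartesian lifting at \<open>g = 1\<^sub>Y\<close>; the next lemma is its dual.\<close>

lemma cocart_leq_at_iff_leq_along:
  assumes lift: "has_liftings F" and f: "f \<in> hom (target F) X Y"
    and A: "A \<in> fibre F X" and B: "B \<in> fibre F Y"
  shows "leq_at F Y (cocart F f A) B \<longleftrightarrow> leq_along F f A B"
proof -
  have Y: "Y \<in> Ob (target F)" and Cod: "Cod (target F) f = Y"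
    using f target.Cod_in by (auto simp: hom_def)
  show ?thesis
    using is_cocartesian_codomain_cocart[OF lift f A] B Cod
      target.Id_in[OF Y] target.Id_Comp[OF f]
    by (auto simp: is_cocartesian_codomain_def fibre_def)
qed

lemma leq_at_cart_iff_leq_along:
  assumes lift: "has_liftings F" and f: "f \<in> hom (target F) X Y"
    and A: "A \<in> fibre F X" and B: "B \<in> fibre F Y"
  shows "leq_at F X A (cart F B f) \<longleftrightarrow> leq_along F f A B"
proof -
  have X: "X \<in> Ob (target F)" and Dom: "Dom (target F) f = X"
    using f target.Dom_in by (auto simp: hom_def)
  show ?thesis
    using is_cartesian_domain_cart[OF lift f B] A Dom
      target.Id_in[OF X] target.Comp_Id[OF f]
    by (auto simp: is_cartesian_domain_def fibre_def)
qed

lemma cocart_cart_galois: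
  assumes "has_liftings F" "f \<in> hom (target F) X Y" "A \<in> fibre F X" "B \<in> fibre F Y"
  shows "leq_at F Y (cocart F f A) B \<longleftrightarrow> leq_at F X A (cart F B f)"
  using cocart_leq_at_iff_leq_along[OF assms] leq_at_cart_iff_leq_along[OF assms] by simp

lemma leq_at_cart_cocart:
  assumes "has_liftings F" "f \<in> hom (target F) X Y" "A \<in> fibre F X"
  shows "leq_at F X A (cart F (cocart F f A) f)"
  using cocart_cart_galois[OF assms cocart_in_fibre[OF assms]]
    leq_at_refl[OF cocart_in_fibre[OF assms]] by simp

lemma cocart_cart_leq_at:
  assumes "has_liftings F" "f \<in> hom (target F) X Y" "B \<in> fibre F Y"
  shows "leq_at F Y (cocart F f (cart F B f)) B"
  using cocart_cart_galois[OF assms(1,2) cart_in_fibre[OF assms] assms(3)]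
    leq_at_refl[OF cart_in_fibre[OF assms]] by simp

lemma topogenous_order_enlarge:
  assumes R: "topogenous_order F R" and X: "X \<in> Ob (target F)"
    and AB: "R X A B" and BB': "leq_at F X B B'"
  shows "R X A B'"
proof -
  have "leq_at F X A A"
    using R X AB leq_at_refl unfolding topogenous_order_def by blast
  then show ?thesis
    using R X AB BB' unfolding topogenous_order_def by blast
qed

end

theorem theorem4p2:
  fixes F :: "('ao, 'am, 'co, 'cm) functor_data"
    and R :: "'co \<Rightarrow> 'ao \<Rightarrow> 'ao \<Rightarrow> bool"
    and X Y :: 'co and f :: 'cm
  assumes "form F"
    and "has_liftings F"
    and "topogenous_order F R"
    and "f \<in> hom (target F) X Y"
  shows "strict_morphism F R X Y f \<longleftrightarrow>
    (\<forall>A \<in> fibre F X. \<forall>B \<in> fibre F X. R X A B \<longrightarrow> R Y (cocart F f A) (cocart F f B))"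
proof -
  interpret form F by fact
  note lift = assms(2) and R = assms(3) and f = assms(4)
  have X: "X \<in> Ob (target F)" and Y: "Y \<in> Ob (target F)"
    using f target.Dom_in target.Cod_in by (auto simp: hom_def)
  show ?thesis
  proof (intro iffI ballI impI)
    fix A B
    assume strict: "strict_morphism F R X Y f"
      and A: "A \<in> fibre F X" and B: "B \<in> fibre F X" and AB: "R X A B"
    have "R X A (cart F (cocart F f B) f)"
      using topogenous_order_enlarge[OF R X AB leq_at_cart_cocart[OF lift f B]] .
    then show "R Y (cocart F f A) (cocart F f B)"
      using strict A cocart_in_fibre[OF lift f B] unfolding strict_morphism_def by blast
  next
    assume pres: "\<forall>A \<in> fibre F X. \<forall>B \<in> fibre F X.
      R X A B \<longrightarrow> R Y (cocart F f A) (cocart F f B)"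
    show "strict_morphism F R X Y f"
      unfolding strict_morphism_def
    proof (intro ballI impI)
      fix A B
      assume A: "A \<in> fibre F X" and B: "B \<in> fibre F Y" and AB: "R X A (cart F B f)"
      have "R Y (cocart F f A) (cocart F f (cart F B f))"
        using pres A cart_in_fibre[OF lift f B] AB by blast
      then show "R Y (cocart F f A) B"
        using topogenous_order_enlarge[OF R Y _ cocart_cart_leq_at[OF lift f B]] by blast
    qed
  qed
qed

end
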